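(* Let $M$ be a real hypersurface in $\hat M^m(c)$, $m\ge 3$, $c\neq 0$, and let $\theta_a=\phi_a\phi-\xi_a\otimes\eta$ for $a\in\{1,2,3\}$, with indices taken modulo $3$. Then for each $a\in\{1,2,3\}$: (a) $\theta_a$ is symmetric; (b) $\operatorname{trace}(\theta_a)=\eta(\xi_a)$; (c) $\theta_a\xi=-\xi_a$, $\theta_a\xi_a=-\xi$, $\theta_a\phi\xi_a=\eta(\xi_a)\phi\xi_a$; (d) $\theta_a\xi_{a+1}=\phi\xi_{a+2}=-\theta_{a+1}\xi_a$; (e) $\theta_a^2-\phi\xi_a\otimes\eta_a\phi=\mathbb I$; (f) $-\theta_a\phi\xi_{a+1}+\eta(\xi_{a+1})\phi\xi_a=\xi_{a+2}=\theta_{a+1}\phi\xi_a-\eta(\xi_a)\phi\xi_{a+1}$; (g) $-\theta_a\theta_{a+1}+\phi\xi_a\otimes\eta_{a+1}\phi=\phi_{a+2}=\theta_{a+1}\theta_a-\phi\xi_{a+1}\otimes\eta_a\phi$; (h) $\theta_a\phi-\phi\xi_a\otimes\eta=-\phi_a=\phi\theta_a-\xi\otimes\eta_a\phi$; (i) $\theta_a\phi_a-\phi\xi_a\otimes\eta_a=-\phi=\phi_a\theta_a-\xi_a\otimes\eta_a\phi$; (j) $\theta_a\phi_{a+1}-\phi\xi_a\otimes\eta_{a+1}=\theta_{a+2}=-\phi_{a+1}\theta_a+\xi_{a+1}\otimes\eta_a\phi$.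
   Context: For $c\neq0$, $\hat M^m(c)$ denotes a complex Grassmannian of rank two (complex dimension $2m$): for $c>0$ it is $SU_{m+2}/S(U_2U_m)$ with the invariant Riemannian metric $g$ scaled so that the maximal sectional curvature is $8c$; for $c<0$ it is $SU_{2,m}/S(U_2U_m)$ with the invariant metric $g$ scaled so that the minimal sectional curvature is $8c$. It carries a Kähler structure $J$ and a quaternionic Kähler structure $\mathfrak J$ (induced by the center and by the factor $\mathfrak{su}_2$ of the isotropy algebra, respectively). A canonical local basis $\{J_1,J_2,J_3\}$ of $\mathfrak J$ consists of local almost Hermitian structures with $J_aJ_{a+1}=J_{a+2}=-J_{a+1}J_a$ (indices mod 3), and $JJ_a=J_aJ$, $\operatorname{trace}(JJ_a)=0$. $M$ is a connected oriented real hypersurface isometrically immersed in $\hat M^m(c)$, with unit normal $N$. For $X\in TM$: $JX=\phi X+\eta(X)N$, $JN=-\xi$, $\eta(X)=g(X,\xi)$; $J_aX=\phi_aX+\eta_a(X)N$, $J_aN=-\xi_a$, $\eta_a(X)=g(X,\xi_a)$. Notation: $(U\otimes\omega)(X)=\omega(X)U$ for a vector $U$ and 1-form $\omega$; $\eta_a\phi$ is the 1-form $X\mapsto\eta_a(\phi X)$; $\mathbb I$ is the identity of $TM$. *)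

theory Defs
  imports "HOL-Analysis.Analysis"
begin

section \<open>Smooth maps between Euclidean spaces\<close>

text \<open>
  Smoothness (of class \<open>C\<^sup>\<infinity>\<close>) on an open set: the map is differentiable and all its directional
  derivatives are again smooth.
\<close>

coinductive smooth_on :: "'a::euclidean_space set \<Rightarrow> ('a \<Rightarrow> 'b::euclidean_space) \<Rightarrow> bool"
  for S :: "'a set"
  where
  "\<lbrakk>\<And>x. x \<in> S \<Longrightarrow> (f has_derivative D x) (at x); \<And>v. smooth_on S (\<lambda>x. D x v)\<rbrakk> \<Longrightarrow> smooth_on S f"

definition smooth_on_subset :: "'a::euclidean_space set \<Rightarrow> ('a \<Rightarrow> 'b::euclidean_space) \<Rightarrow> bool"
  where "smooth_on_subset S f \<longleftrightarrow>
    (\<forall>x\<in>S. \<exists>O' F. open O' \<and> x \<in> O' \<and> smooth_on O' F \<and> (\<forall>y\<in>O' \<inter> S. F y = f y))"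


section \<open>Complex Grassmannians of rank two\<close>

text \<open>
  Vectors of \<open>\<complex>\<^sup>m\<^sup>+\<^sup>2\<close> are indexed by the sum type \<open>2 + 'm\<close>, with \<open>m = CARD('m)\<close>; the summand
  \<open>2\<close> belongs to the reference 2-plane. The sign of \<open>c\<close> selects the definite or the indefinite
  Hermitian form.
\<close>

type_synonym 'm cmat = "complex ^ (2 + 'm) ^ (2 + 'm)"

definition cadjoint :: "('m::finite) cmat \<Rightarrow> 'm cmat"
  where "cadjoint A = (\<chi> i j. cnj (A $ j $ i))"

definition lie :: "('m::finite) cmat \<Rightarrow> 'm cmat \<Rightarrow> 'm cmat"
  where "lie A B = A ** B - B ** A"

definition herm_form :: "real \<Rightarrow> ('m::finite) cmat"
  where "herm_form c = (\<chi> i j. if i \<noteq> j then 0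
           else case i of Inl _ \<Rightarrow> (if c < 0 then - 1 else 1) | Inr _ \<Rightarrow> 1)"

text \<open>\<open>SU\<^bsub>m+2\<^esub>\<close> for \<open>c > 0\<close>, \<open>SU\<^bsub>2,m\<^esub>\<close> for \<open>c < 0\<close>, and the Lie algebra.\<close>

definition isometry_group :: "real \<Rightarrow> ('m::finite) cmat set"
  where "isometry_group c = {A. cadjoint A ** herm_form c ** A = herm_form c \<and> det A = 1}"

definition isometry_alg :: "real \<Rightarrow> ('m::finite) cmat set"
  where "isometry_alg c = {U. cadjoint U ** herm_form c + herm_form c ** U = 0 \<and> trace U = 0}"

definition base_point :: "('m::finite) cmat"
  where "base_point = (\<chi> i j. if i = j \<and> (\<exists>k. i = Inl k) then 1 else 0)"

definition conj_by :: "('m::finite) cmat \<Rightarrow> 'm cmat \<Rightarrow> 'm cmat"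
  where "conj_by A X = A ** X ** matrix_inv A"

text \<open>
  The stabilizer of \<open>base_point\<close> under conjugation is \<open>S(U\<^sub>2U\<^sub>m)\<close>, so the homogeneous space
  \<open>SU\<^bsub>m+2\<^esub>/S(U\<^sub>2U\<^sub>m)\<close> (respectively \<open>SU\<^bsub>2,m\<^esub>/S(U\<^sub>2U\<^sub>m)\<close>) is realized as the orbit of \<open>base_point\<close>,
  a closed embedded submanifold of the space of matrices. Its points are the projections onto
  2-planes (negative definite ones for \<open>c < 0\<close>) along the orthogonal complement.
\<close>

definition grassmannian :: "real \<Rightarrow> ('m::finite) cmat set"
  where "grassmannian c = {conj_by A base_point | A. A \<in> isometry_group c}"

definition grass_tangent :: "real \<Rightarrow> ('m::finite) cmat \<Rightarrow> 'm cmat set"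
  where "grass_tangent c P = {lie U P | U. U \<in> isometry_alg c}"

definition isotropy_alg :: "real \<Rightarrow> ('m::finite) cmat \<Rightarrow> 'm cmat set"
  where "isotropy_alg c P = {U \<in> isometry_alg c. lie U P = 0}"

definition isotropy_center :: "real \<Rightarrow> ('m::finite) cmat \<Rightarrow> 'm cmat set"
  where "isotropy_center c P = {Z \<in> isotropy_alg c P. \<forall>U\<in>isotropy_alg c P. lie Z U = 0}"

text \<open>
  The ideal \<open>su\<^sub>2\<close> of the isotropy algebra \<open>s(u\<^sub>2 \<oplus> u\<^sub>m)\<close>: the elements which vanish on the orthogonal
  complement of the 2-plane \<open>P\<close>.
\<close>

definition isotropy_su2 :: "real \<Rightarrow> ('m::finite) cmat \<Rightarrow> 'm cmat set"
  where "isotropy_su2 c P = {U \<in> isotropy_alg c P. U ** P = U}"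


subsection \<open>The invariant metric\<close>

type_synonym 'm metric = "'m cmat \<Rightarrow> 'm cmat \<Rightarrow> 'm cmat \<Rightarrow> real"

definition inner_product_on :: "'v::real_vector set \<Rightarrow> ('v \<Rightarrow> 'v \<Rightarrow> real) \<Rightarrow> bool"
  where "inner_product_on T b \<longleftrightarrow>
    (\<forall>X\<in>T. \<forall>Y\<in>T. \<forall>Z\<in>T. b (X + Y) Z = b X Z + b Y Z) \<and>
    (\<forall>X\<in>T. \<forall>Z\<in>T. \<forall>r. b (r *\<^sub>R X) Z = r * b X Z) \<and>
    (\<forall>X\<in>T. \<forall>Y\<in>T. b X Y = b Y X) \<and>
    (\<forall>X\<in>T. X \<noteq> 0 \<longrightarrow> b X X > 0)"

definition invariant_metric :: "real \<Rightarrow> ('m::finite) metric \<Rightarrow> bool"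
  where "invariant_metric c g \<longleftrightarrow>
    (\<forall>P\<in>grassmannian c. inner_product_on (grass_tangent c P) (g P)) \<and>
    (\<forall>A\<in>isometry_group c. \<forall>P\<in>grassmannian c. \<forall>X\<in>grass_tangent c P. \<forall>Y\<in>grass_tangent c P.
       g (conj_by A P) (conj_by A X) (conj_by A Y) = g P X Y)"

text \<open>
  Curvature tensor of the symmetric space at \<open>P\<close>, by \<open>R(X,Y)Z = - [[X,Y],Z]\<close> on the complement \<open>\<pp>\<close> of
  the isotropy algebra. The element of \<open>\<pp>\<close> which represents the tangent vector \<open>X\<close> is \<open>lie X P\<close>,
  and the isotropy algebra acts on tangent vectors by \<open>lie\<close>.
\<close>

definition curvature :: "('m::finite) cmat \<Rightarrow> 'm cmat \<Rightarrow> 'm cmat \<Rightarrow> 'm cmat \<Rightarrow> 'm cmat"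
  where "curvature P X Y Z = - lie (lie (lie X P) (lie Y P)) Z"

definition sectional_curvature :: "('m::finite) metric \<Rightarrow> 'm cmat \<Rightarrow> 'm cmat \<Rightarrow> 'm cmat \<Rightarrow> real"
  where "sectional_curvature g P X Y =
    g P (curvature P X Y Y) X / (g P X X * g P Y Y - (g P X Y)\<^sup>2)"

definition sectional_curvatures :: "real \<Rightarrow> ('m::finite) metric \<Rightarrow> real set"
  where "sectional_curvatures c g =
    {sectional_curvature g P X Y | P X Y. P \<in> grassmannian c \<and> X \<in> grass_tangent c P \<and>
       Y \<in> grass_tangent c P \<and> X \<noteq> Y \<and> independent {X, Y}}"

definition grassmannian_metric :: "real \<Rightarrow> ('m::finite) metric \<Rightarrow> bool"
  where "grassmannian_metric c g \<longleftrightarrow> invariant_metric c g \<and>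
    8 * c \<in> sectional_curvatures c g \<and>
    (\<forall>k\<in>sectional_curvatures c g. if c > 0 then k \<le> 8 * c else 8 * c \<le> k)"


subsection \<open>The Kaehler and the quaternionic Kaehler structure\<close>

type_synonym 'm endo_field = "'m cmat \<Rightarrow> 'm cmat \<Rightarrow> 'm cmat"

definition almost_hermitian_at ::
    "real \<Rightarrow> ('m::finite) metric \<Rightarrow> 'm cmat \<Rightarrow> ('m cmat \<Rightarrow> 'm cmat) \<Rightarrow> bool"
  where "almost_hermitian_at c g P L \<longleftrightarrow>
    (\<forall>X\<in>grass_tangent c P. L X \<in> grass_tangent c P \<and> L (L X) = - X) \<and>
    (\<forall>X\<in>grass_tangent c P. \<forall>Y\<in>grass_tangent c P. g P (L X) (L Y) = g P X Y)"

text \<open>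
  The invariant almost Hermitian structure given by the center of the isotropy algebra (which
  is one-dimensional, so that the structure is unique up to a global sign; being invariant on a
  symmetric space it is parallel).
\<close>

definition kahler_structure :: "real \<Rightarrow> ('m::finite) metric \<Rightarrow> 'm endo_field \<Rightarrow> bool"
  where "kahler_structure c g J \<longleftrightarrow>
    (\<forall>P\<in>grassmannian c. almost_hermitian_at c g P (J P) \<and>
       (\<exists>Z\<in>isotropy_center c P. \<forall>X\<in>grass_tangent c P. J P X = lie Z X)) \<and>
    (\<forall>A\<in>isometry_group c. \<forall>P\<in>grassmannian c. \<forall>X\<in>grass_tangent c P.
       J (conj_by A P) (conj_by A X) = conj_by A (J P X))"

text \<open>
  Canonical local bases, over the open set \<open>W\<close>, of the rank-three bundle whose fibre over \<open>P\<close> consists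
  of the endomorphisms \<open>lie U\<close>, with \<open>U\<close> in the ideal \<open>su\<^sub>2\<close> of the isotropy algebra at \<open>P\<close>; linear
  independence follows from the multiplication rules. The indices range over the type \<open>3\<close> of
  integers modulo 3.
\<close>

definition canonical_local_basis ::
    "real \<Rightarrow> ('m::finite) metric \<Rightarrow> 'm cmat set \<Rightarrow> (3 \<Rightarrow> 'm endo_field) \<Rightarrow> bool"
  where "canonical_local_basis c g W Js \<longleftrightarrow>
    openin (top_of_set (grassmannian c)) W \<and>
    (\<exists>U. \<forall>a. smooth_on_subset W (U a) \<and>
       (\<forall>P\<in>W. U a P \<in> isotropy_su2 c P \<and> (\<forall>X\<in>grass_tangent c P. Js a P X = lie (U a P) X))) \<and>
    (\<forall>P\<in>W. \<forall>a. almost_hermitian_at c g P (Js a P) \<and>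
       (\<forall>X\<in>grass_tangent c P.
          Js a P (Js (a + 1) P X) = Js (a + 2) P X \<and>
          Js (a + 2) P X = - Js (a + 1) P (Js a P X)))"


section \<open>Real hypersurfaces\<close>

text \<open>
  Smooth manifold structures on a topological space, given by local parametrizations \<open>\<psi>\<close> (inverses
  of charts) with open domains \<open>V\<close> in the model space.
\<close>

type_synonym ('e, 'p) atlas = "('e set \<times> ('e \<Rightarrow> 'p)) set"

definition smooth_atlas :: "('e::euclidean_space, 'p::topological_space) atlas \<Rightarrow> bool"
  where "smooth_atlas \<A> \<longleftrightarrow>
    (\<forall>(V, \<psi>)\<in>\<A>. open V \<and> open (\<psi> ` V) \<and> (\<exists>\<rho>. homeomorphism V (\<psi> ` V) \<psi> \<rho>)) \<and>
    (\<Union>(V, \<psi>)\<in>\<A>. \<psi> ` V) = UNIV \<and>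
    (\<forall>(V, \<psi>)\<in>\<A>. \<forall>(W, \<rho>)\<in>\<A>. smooth_on (V \<inter> \<psi> -` (\<rho> ` W)) (inv_into W \<rho> \<circ> \<psi>))"

definition smooth_map :: "('e::euclidean_space, 'p) atlas \<Rightarrow> ('p \<Rightarrow> 'b::euclidean_space) \<Rightarrow> bool"
  where "smooth_map \<A> f \<longleftrightarrow> (\<forall>(V, \<psi>)\<in>\<A>. smooth_on V (f \<circ> \<psi>))"

definition smooth_immersion :: "('e::euclidean_space, 'p) atlas \<Rightarrow> ('p \<Rightarrow> 'b::euclidean_space) \<Rightarrow> bool"
  where "smooth_immersion \<A> f \<longleftrightarrow> smooth_map \<A> f \<and>
    (\<forall>(V, \<psi>)\<in>\<A>. \<forall>v\<in>V. inj (frechet_derivative (f \<circ> \<psi>) (at v)))"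

text \<open>
  The tangent space at \<open>p\<close> of an immersed manifold, identified with its image under the
  differential of the immersion; the induced metric is then the restriction of the ambient one.
\<close>

definition immersed_tangent ::
    "('e::euclidean_space, 'p) atlas \<Rightarrow> ('p \<Rightarrow> 'b::euclidean_space) \<Rightarrow> 'p \<Rightarrow> 'b set"
  where "immersed_tangent \<A> f p =
    {frechet_derivative (f \<circ> \<psi>) (at v) w | V \<psi> v w. (V, \<psi>) \<in> \<A> \<and> v \<in> V \<and> \<psi> v = p}"

text \<open>
  The hypersurface is the whole type \<open>'p\<close>. As the ambient manifold is orientable, an orientation
  amounts to the choice of the global unit normal field \<open>N\<close>.
\<close>

definition oriented_real_hypersurface ::
    "real \<Rightarrow> ('m::finite) metric \<Rightarrow>
     ('e::euclidean_space, 'p::{t2_space, second_countable_topology}) atlas \<Rightarrow>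
     ('p \<Rightarrow> 'm cmat) \<Rightarrow> ('p \<Rightarrow> 'm cmat) \<Rightarrow> bool"
  where "oriented_real_hypersurface c g \<A> f N \<longleftrightarrow>
    DIM('e) = 4 * CARD('m) - 1 \<and>
    connected (UNIV :: 'p set) \<and> smooth_atlas \<A> \<and>
    smooth_immersion \<A> f \<and> range f \<subseteq> grassmannian c \<and>
    smooth_map \<A> N \<and>
    (\<forall>p. N p \<in> grass_tangent c (f p) \<and> g (f p) (N p) (N p) = 1 \<and>
         (\<forall>X\<in>immersed_tangent \<A> f p. g (f p) X (N p) = 0))"


subsection \<open>Tensors on the hypersurface\<close>

text \<open>
  In what follows \<open>b\<close> is the inner product on the ambient tangent space, \<open>n\<close> the unit normal and
  \<open>L\<close> one of the almost Hermitian structures: \<open>L X = \<phi> X + \<eta>(X) n\<close> for tangent \<open>X\<close>, \<open>L n = - \<xi>\<close>.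
\<close>

definition struct_vec :: "('v::real_vector \<Rightarrow> 'v) \<Rightarrow> 'v \<Rightarrow> 'v"
  where "struct_vec L n = - L n"

definition struct_form :: "('v::real_vector \<Rightarrow> 'v \<Rightarrow> real) \<Rightarrow> ('v \<Rightarrow> 'v) \<Rightarrow> 'v \<Rightarrow> 'v \<Rightarrow> real"
  where "struct_form b L n X = b X (struct_vec L n)"

definition struct_endo :: "('v::real_vector \<Rightarrow> 'v \<Rightarrow> real) \<Rightarrow> ('v \<Rightarrow> 'v) \<Rightarrow> 'v \<Rightarrow> 'v \<Rightarrow> 'v"
  where "struct_endo b L n X = L X - struct_form b L n X *\<^sub>R n"

definition tensor :: "'v::real_vector \<Rightarrow> ('v \<Rightarrow> real) \<Rightarrow> 'v \<Rightarrow> 'v"  (infix "\<otimes>" 75)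
  where "(U \<otimes> \<omega>) X = \<omega> X *\<^sub>R U"

definition symmetric_on ::
    "'v::real_vector set \<Rightarrow> ('v \<Rightarrow> 'v \<Rightarrow> real) \<Rightarrow> ('v \<Rightarrow> 'v) \<Rightarrow> bool"
  where "symmetric_on T b L \<longleftrightarrow>
    (\<forall>X\<in>T. L X \<in> T) \<and> (\<forall>X\<in>T. \<forall>Y\<in>T. b (L X) Y = b X (L Y))"

text \<open>Trace of an endomorphism of the subspace \<open>T\<close>, computed in an arbitrary basis.\<close>

definition trace_on :: "'v::real_vector set \<Rightarrow> ('v \<Rightarrow> 'v) \<Rightarrow> real"
  where "trace_on T L =
    (let B = (SOME B. independent B \<and> span B = T) in \<Sum>b\<in>B. representation B (L b) b)"

end

theory Submission
  imports Defs
begin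

text \<open>
  Let \<open>V\<close> be the tangent space of the Grassmannian at the point under consideration, \<open>n\<close> the unit
  normal and \<open>T\<close> the tangent space of the hypersurface. Then \<open>T\<close> is the orthogonal complement of \<open>n\<close>
  in \<open>V\<close>, and with the orthogonal projection \<open>pr\<close> of \<open>V\<close> onto it,
  \<open>\<phi> = pr \<circ> J\<close>, \<open>\<phi>\<^sub>a = pr \<circ> J\<^sub>a\<close>, \<open>\<xi> = - J n\<close> and \<open>\<xi>\<^sub>a = - J\<^sub>a n\<close>. The correction term in
  \<open>\<theta>\<^sub>a = \<phi>\<^sub>a \<phi> - \<xi>\<^sub>a \<otimes> \<eta>\<close> is precisely the one that makes \<open>\<theta>\<^sub>a = pr \<circ> J J\<^sub>a\<close>. So all tensors in
  question are compressions of products of the structures, and the rule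
  \<open>pr (A (pr Y)) = pr (A Y) - g(Y, n) pr (A n)\<close> (lemma \<open>proj_compose\<close>) turns every composition
  identity into the relations \<open>J\<^sup>2 = J\<^sub>a\<^sup>2 = - 1\<close>, \<open>J J\<^sub>a = J\<^sub>a J\<close>, \<open>J\<^sub>a J\<^sub>a\<^sub>+\<^sub>1 = J\<^sub>a\<^sub>+\<^sub>2 = - J\<^sub>a\<^sub>+\<^sub>1 J\<^sub>a\<close>.
  Symmetry holds because \<open>J J\<^sub>a\<close> is a product of two commuting skew maps. For the trace, \<open>J J\<^sub>a\<close>
  anticommutes with the bijection \<open>J\<^sub>a\<^sub>+\<^sub>1\<close>, hence is traceless on \<open>V\<close>, and compression to \<open>T\<close> takes away
  the diagonal entry \<open>g(J J\<^sub>a n, n) = - \<eta>(\<xi>\<^sub>a)\<close>.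

  It remains to see that the concrete geometry has this shape. The structures commute because they
  are brackets with elements \<open>Z\<close>, \<open>U\<^sub>a\<close> of the isotropy algebra, \<open>Z\<close> central. That \<open>T\<close> is the whole
  complement of \<open>n\<close> is a dimension count. On the one hand, points \<open>P\<close> of the Grassmannian satisfy
  \<open>P\<^sup>2 = P\<close> and \<open>P\<^sup>* H = H P\<close>, with \<open>H\<close> the matrix of the Hermitian form, and the
  linearization of these equations cuts out precisely \<open>V\<close> (lemma \<open>grass_tangent_iff\<close>), so that
  derivatives of maps into the Grassmannian lie in \<open>V\<close>. On the other hand \<open>dim V \<le> 4 m\<close>, while
  the differential of one local parametrization is injective on a space of dimension \<open>4 m - 1\<close>.
\<close>

section \<open>Traces of endomorphisms of a subspace\<close>

text \<open>
  The structures are given as functions on all matrices, but only their values on the tangent space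
  are controlled; hence linearity is asked for on \<open>V\<close> alone.
\<close>

definition endo_on :: "'v::real_vector set \<Rightarrow> ('v \<Rightarrow> 'v) \<Rightarrow> bool"
  where "endo_on V L \<longleftrightarrow> (\<forall>X\<in>V. L X \<in> V) \<and> (\<forall>X\<in>V. \<forall>Y\<in>V. L (X + Y) = L X + L Y) \<and>
    (\<forall>X\<in>V. \<forall>r. L (r *\<^sub>R X) = r *\<^sub>R L X)"

lemma endo_on_mem: "endo_on V L \<Longrightarrow> X \<in> V \<Longrightarrow> L X \<in> V"
  by (simp add: endo_on_def)

lemma endo_on_scale: "endo_on V L \<Longrightarrow> X \<in> V \<Longrightarrow> L (r *\<^sub>R X) = r *\<^sub>R L X"
  by (simp add: endo_on_def)

lemma endo_on_minus: "endo_on V L \<Longrightarrow> X \<in> V \<Longrightarrow> L (- X) = - L X"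
  using endo_on_scale[of V L X "- 1"] by simp

lemma endo_on_add: "endo_on V L \<Longrightarrow> X \<in> V \<Longrightarrow> Y \<in> V \<Longrightarrow> L (X + Y) = L X + L Y"
  by (simp add: endo_on_def)

lemma endo_on_diff:
  assumes "endo_on V L" "subspace V" "X \<in> V" "Y \<in> V"
  shows "L (X - Y) = L X - L Y"
  using endo_on_add[OF assms(1,3) subspace_neg[OF assms(2,4)]] endo_on_minus[OF assms(1,4)] by simp

lemma endo_on_sum:
  assumes "endo_on V L" "subspace V" "\<And>i. i \<in> I \<Longrightarrow> h i \<in> V"
  shows "L (\<Sum>i\<in>I. h i) = (\<Sum>i\<in>I. L (h i))"
proof -
  have "L 0 = 0"
    using endo_on_scale[OF assms(1) subspace_0[OF assms(2)], of 0] by simp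
  then show ?thesis
    using assms(3)
    by (induction I rule: infinite_finite_induct)
      (simp_all add: endo_on_add[OF assms(1)] subspace_sum[OF assms(2)])
qed

lemma endo_on_compose: "endo_on V K \<Longrightarrow> endo_on V L \<Longrightarrow> endo_on V (\<lambda>X. K (L X))"
  by (simp add: endo_on_def)

lemma endo_on_combination:
  assumes "endo_on V L" "subspace V" "\<And>i. i \<in> I \<Longrightarrow> v i \<in> V"
  shows "L (\<Sum>i\<in>I. u i *\<^sub>R v i) = (\<Sum>i\<in>I. u i *\<^sub>R L (v i))"
proof -
  have "L (\<Sum>i\<in>I. u i *\<^sub>R v i) = (\<Sum>i\<in>I. L (u i *\<^sub>R v i))"
    using assms by (intro endo_on_sum) (auto intro: subspace_scale)
  also have "\<dots> = (\<Sum>i\<in>I. u i *\<^sub>R L (v i))"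
    using assms by (intro sum.cong refl endo_on_scale)
  finally show ?thesis .
qed

lemma representation_combination:
  assumes "independent B" "\<And>i. i \<in> I \<Longrightarrow> v i \<in> span B"
  shows "representation B (\<Sum>i\<in>I. u i *\<^sub>R v i) x = (\<Sum>i\<in>I. u i * representation B (v i) x)"
proof -
  have "representation B (\<Sum>i\<in>I. u i *\<^sub>R v i) x = (\<Sum>i\<in>I. representation B (u i *\<^sub>R v i) x)"
    using assms by (subst representation_sum) (simp_all add: span_scale)
  also have "\<dots> = (\<Sum>i\<in>I. u i * representation B (v i) x)"
    using assms by (intro sum.cong refl) (simp add: representation_scale)
  finally show ?thesis .
qed

lemma basis_expansion:
  assumes "independent B" "finite B" "X \<in> span B"
  shows "(\<Sum>x\<in>B. representation B X x *\<^sub>R x) = X"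
  using assms by (intro sum_representation_eq) auto

text \<open>
  The value of \<open>trace_on\<close> rests on a choice of basis \<open>B\<close>. The choice is immaterial: expanding
  \<open>L x\<close> for \<open>x \<in> B\<close> in the basis \<open>C\<close>, and then \<open>y \<in> C\<close> in the basis \<open>B\<close>, gives the same double
  sum as the diagonal of \<open>L\<close> with respect to \<open>C\<close>.
\<close>

lemma trace_on_basis:
  fixes V :: "'v::euclidean_space set"
  assumes L: "endo_on V L" and C: "independent C" "span C = V"
  shows "trace_on V L = (\<Sum>x\<in>C. representation C (L x) x)"
proof -
  define B where "B = (SOME B. independent B \<and> span B = V)"
  have "independent B \<and> span B = V"
    unfolding B_def using C by (metis (mono_tags, lifting) someI_ex)
  then have B: "independent B" "span B = V" by auto
  have fin: "finite B" "finite C"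
    using B C by (simp_all add: independent_imp_finite)
  have V: "subspace V" using C by auto
  have BV: "x \<in> V" if "x \<in> B" for x using that B(2) span_base by blast
  have CV: "y \<in> V" if "y \<in> C" for y using that C(2) span_base by blast
  have LV: "L x \<in> V" if "x \<in> V" for x
    using L that by (rule endo_on_mem)
  have "representation B (L x) x = (\<Sum>y\<in>C. representation C (L x) y * representation B y x)"
    if x: "x \<in> B" for x
    using representation_combination[OF B(1), of C "\<lambda>y. y" "representation C (L x)" x]
      basis_expansion[OF C(1) fin(2), of "L x"] B(2) C(2) CV BV[OF x] LV by simp
  then have "(\<Sum>x\<in>B. representation B (L x) x) =
      (\<Sum>x\<in>B. \<Sum>y\<in>C. representation C (L x) y * representation B y x)"
    by simp
  also have "\<dots> = (\<Sum>y\<in>C. \<Sum>x\<in>B. representation B y x * representation C (L x) y)"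
    by (subst sum.swap) (simp add: mult.commute)
  also have "\<dots> = (\<Sum>y\<in>C. representation C (L y) y)"
  proof (rule sum.cong[OF refl])
    fix y assume y: "y \<in> C"
    have "L y = L (\<Sum>x\<in>B. representation B y x *\<^sub>R x)"
      using basis_expansion[OF B(1) fin(1), of y] B(2) CV[OF y] by simp
    also have "\<dots> = (\<Sum>x\<in>B. representation B y x *\<^sub>R L x)"
      using BV by (intro endo_on_combination[OF L V])
    finally have "representation C (L y) y =
        representation C (\<Sum>x\<in>B. representation B y x *\<^sub>R L x) y" by simp
    also have "\<dots> = (\<Sum>x\<in>B. representation B y x * representation C (L x) y)"
      using BV LV C(2) by (intro representation_combination[OF C(1)]) simp
    finally show "(\<Sum>x\<in>B. representation B y x * representation C (L x) y) = representation C (L y) y"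
      by simp
  qed
  finally show ?thesis by (simp add: trace_on_def B_def Let_def)
qed

lemma subspace_basis:
  fixes V :: "'v::euclidean_space set"
  assumes "subspace V"
  obtains B where "independent B" "span B = V" "finite B"
  by (metis assms basis_exists independent_imp_finite span_subspace)

text \<open>
  If \<open>K\<close> is bijective on \<open>V\<close> then \<open>L\<close> is conjugate to \<open>- L\<close>. Concretely, the diagonal entries of \<open>L\<close>
  with respect to the basis \<open>K ` B\<close> are those of \<open>- L\<close> with respect to \<open>B\<close>.
\<close>

lemma trace_on_anticommute:
  fixes V :: "'v::euclidean_space set"
  assumes V: "subspace V" and L: "endo_on V L" and K: "endo_on V K"
    and surj: "V \<subseteq> K ` V"
    and LK: "\<And>X. X \<in> V \<Longrightarrow> L (K X) = - K (L X)"
  shows "trace_on V L = 0"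
proof -
  obtain B where B: "independent B" "span B = V" "finite B"
    using subspace_basis[OF V] .
  have BV: "x \<in> V" if "x \<in> B" for x using that B(2) span_base by blast
  have KX: "K X = (\<Sum>x\<in>B. representation B X x *\<^sub>R K x)" if "X \<in> V" for X
    using endo_on_combination[OF K V, of B "\<lambda>x. x" "representation B X"] BV
      basis_expansion[OF B(1) B(3), of X] B(2) that by simp
  have spanK: "span (K ` B) = V"
  proof
    show "span (K ` B) \<subseteq> V"
      using BV endo_on_mem[OF K] by (intro span_minimal[OF _ V]) auto
    show "V \<subseteq> span (K ` B)"
    proof
      fix Y assume "Y \<in> V"
      then obtain X where X: "X \<in> V" "Y = K X" using surj by auto
      show "Y \<in> span (K ` B)"
        unfolding X(2) KX[OF X(1)] by (intro span_sum span_scale span_base imageI)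
    qed
  qed
  have cardKB: "card (K ` B) = card B"
  proof (rule antisym)
    show "card (K ` B) \<le> card B" using B(3) by (rule card_image_le)
    show "card B \<le> card (K ` B)"
      using independent_span_bound[of "K ` B" B] B spanK BV by auto
  qed
  have inj: "inj_on K B" using cardKB B(3) by (simp add: eq_card_imp_inj_on)
  have "dim V = card B" using B(1,2) by (metis dim_span_eq_card_independent)
  then have indepK: "independent (K ` B)"
    using cardKB spanK B(3) endo_on_mem[OF K] BV by (intro card_le_dim_spanning[of _ V]) auto
  have repK: "representation (K ` B) (K X) (K x) = representation B X x" if "X \<in> V" "x \<in> B" for X x
  proof -
    have "representation (K ` B) (K X) (K x) =
        (\<Sum>y\<in>B. representation B X y * representation (K ` B) (K y) (K x))"
      unfolding KX[OF that(1)]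
      by (intro representation_combination[OF indepK] span_base imageI)
    also have "\<dots> = (\<Sum>y\<in>B. if y = x then representation B X x else 0)"
      using representation_basis[OF indepK] inj that(2)
      by (intro sum.cong) (auto simp: inj_on_eq_iff)
    finally show ?thesis using that(2) B(3) by simp
  qed
  have "trace_on V L = (\<Sum>y\<in>K ` B. representation (K ` B) (L y) y)"
    by (rule trace_on_basis[OF L indepK spanK])
  also have "\<dots> = (\<Sum>x\<in>B. representation (K ` B) (L (K x)) (K x))"
    by (simp add: sum.reindex[OF inj])
  also have "\<dots> = (\<Sum>x\<in>B. - representation B (L x) x)"
  proof (rule sum.cong[OF refl])
    fix x assume x: "x \<in> B"
    then have xV: "x \<in> V" "L x \<in> V" using BV endo_on_mem[OF L] by auto
    have "L (K x) = K (- L x)"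
      using LK xV endo_on_minus[OF K] by simp
    then have "representation (K ` B) (L (K x)) (K x) = representation B (- L x) x"
      using repK[of "- L x" x] x xV V by (simp add: subspace_neg)
    also have "\<dots> = - representation B (L x) x"
      using representation_neg[OF B(1), of "L x"] xV B(2) by simp
    finally show "representation (K ` B) (L (K x)) (K x) = - representation B (L x) x" .
  qed
  also have "\<dots> = - trace_on V L"
    by (simp add: trace_on_basis[OF L B(1,2)] sum_negf)
  finally show ?thesis by simp
qed

lemma trace_on_cong:
  fixes V :: "'v::euclidean_space set"
  assumes "subspace V" and "\<And>X. X \<in> V \<Longrightarrow> K X = L X"
  shows "trace_on V K = trace_on V L"
proof -
  define B where "B = (SOME B. independent B \<and> span B = V)"
  have "\<exists>B. independent B \<and> span B = V"
    using subspace_basis[OF assms(1)] by metis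
  then have "independent B \<and> span B = V"
    unfolding B_def by (rule someI_ex)
  then have "B \<subseteq> V" using span_superset by blast
  then show ?thesis
    using assms(2) by (auto simp: trace_on_def B_def[symmetric] Let_def intro!: sum.cong)
qed

section \<open>The orthogonal complement of a unit normal\<close>

locale unit_normal =
  fixes V :: "'v::euclidean_space set" and b :: "'v \<Rightarrow> 'v \<Rightarrow> real" and n :: 'v
  assumes V: "subspace V" and inner: "inner_product_on V b"
    and n: "n \<in> V" and unit: "b n n = 1"
begin

lemma sym: "X \<in> V \<Longrightarrow> Y \<in> V \<Longrightarrow> b X Y = b Y X"
  and add_left: "X \<in> V \<Longrightarrow> Y \<in> V \<Longrightarrow> Z \<in> V \<Longrightarrow> b (X + Y) Z = b X Z + b Y Z"
  and scale_left: "X \<in> V \<Longrightarrow> Z \<in> V \<Longrightarrow> b (r *\<^sub>R X) Z = r * b X Z"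
  using inner by (simp_all add: inner_product_on_def)

lemma minus_left: "X \<in> V \<Longrightarrow> Z \<in> V \<Longrightarrow> b (- X) Z = - b X Z"
  using scale_left[of X Z "- 1"] by simp

lemma diff_left: "X \<in> V \<Longrightarrow> Y \<in> V \<Longrightarrow> Z \<in> V \<Longrightarrow> b (X - Y) Z = b X Z - b Y Z"
  using add_left[of X "- Y" Z] minus_left[of Y Z] subspace_neg[OF V] by simp

lemma minus_right: "X \<in> V \<Longrightarrow> Z \<in> V \<Longrightarrow> b X (- Z) = - b X Z"
  using minus_left sym subspace_neg[OF V] by simp

definition hyperplane :: "'v set"
  where "hyperplane = {X \<in> V. b X n = 0}"

definition proj :: "'v \<Rightarrow> 'v"
  where "proj X = X - b X n *\<^sub>R n"

lemma hyperplane_sub: "X \<in> hyperplane \<Longrightarrow> X \<in> V"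
  by (simp add: hyperplane_def)

lemma subspace_hyperplane: "subspace hyperplane"
  using subspace_0[OF V] subspace_add[OF V] subspace_scale[OF V] scale_left[OF n n, of 0]
    scale_left[OF subspace_0[OF V] n, of 0]
  by (auto simp: subspace_def hyperplane_def add_left scale_left n)

lemma proj_mem: "X \<in> V \<Longrightarrow> proj X \<in> hyperplane"
  using n unit subspace_scale[OF V n] subspace_diff[OF V]
  by (simp add: proj_def hyperplane_def diff_left scale_left)

lemma proj_id: "X \<in> hyperplane \<Longrightarrow> proj X = X"
  by (simp add: proj_def hyperplane_def)

lemma proj_normal: "proj n = 0"
  by (simp add: proj_def unit)

lemma proj_minus: "X \<in> V \<Longrightarrow> proj (- X) = - proj X"
  by (simp add: proj_def minus_left n)

lemma endo_on_proj: "endo_on V proj"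
  using proj_mem hyperplane_sub n
  by (auto simp: endo_on_def proj_def add_left scale_left algebra_simps)

text \<open>
  This is the one computational rule behind all composition identities: an inner projection costs
  the image of the normal part which it removes.
\<close>

lemma proj_compose:
  assumes A: "endo_on V A" and Y: "Y \<in> V"
  shows "proj (A (proj Y)) = proj (A Y) - b Y n *\<^sub>R proj (A n)"
proof -
  have "A (proj Y) = A Y - b Y n *\<^sub>R A n"
    unfolding proj_def
    using endo_on_diff[OF A V Y subspace_scale[OF V n]] endo_on_scale[OF A n] by simp
  then show ?thesis
    using endo_on_diff[OF endo_on_proj V] endo_on_scale[OF endo_on_proj]
      endo_on_mem[OF A] Y n subspace_scale[OF V] by simp
qed

lemma independent_insert_normal:
  assumes "independent B" "span B = hyperplane"
  shows "independent (insert n B)" "span (insert n B) = V"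
proof -
  have "n \<notin> span B" using assms unit by (simp add: hyperplane_def)
  then show "independent (insert n B)" using assms by (simp add: independent_insertI)
  show "span (insert n B) = V"
  proof
    have "B \<subseteq> V" using assms span_superset hyperplane_sub by blast
    then show "span (insert n B) \<subseteq> V" using n by (intro span_minimal[OF _ V]) simp
    show "V \<subseteq> span (insert n B)"
    proof
      fix X assume "X \<in> V"
      then have "X - b X n *\<^sub>R n \<in> span B" using proj_mem assms by (simp add: proj_def)
      then show "X \<in> span (insert n B)" by (auto simp: span_breakdown_eq)
    qed
  qed
qed

lemma dim_hyperplane: "dim V = dim hyperplane + 1"
proof -
  obtain B where B: "independent B" "span B = hyperplane" "finite B"
    using subspace_basis[OF subspace_hyperplane] .
  note C = independent_insert_normal[OF B(1,2)]
  have "n \<notin> B" using span_base[of n B] unit unfolding B(2) hyperplane_def by auto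
  then have "card (insert n B) = card B + 1" using B(3) by simp
  moreover have "dim V = card (insert n B)" using C by (metis dim_span_eq_card_independent)
  moreover have "dim hyperplane = card B" using B by (metis dim_span_eq_card_independent)
  ultimately show ?thesis by simp
qed

text \<open>
  Extending a basis of the hyperplane by \<open>n\<close> leaves the old diagonal entries unchanged, and adds the
  entry of \<open>n\<close>.
\<close>

lemma trace_on_hyperplane:
  assumes L: "endo_on V L"
  shows "trace_on hyperplane (\<lambda>X. proj (L X)) = trace_on V L - b (L n) n"
proof -
  obtain B where B: "independent B" "span B = hyperplane" "finite B"
    using subspace_basis[OF subspace_hyperplane] .
  let ?C = "insert n B"
  note C = independent_insert_normal[OF B(1,2)]
  have nB: "n \<notin> B" using span_base[of n B] unit unfolding B(2) hyperplane_def by auto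
  have rep_n: "representation ?C n x = (if x = n then 1 else 0)" for x
    using representation_basis[OF C(1), of n] by simp
  have rep: "representation ?C X = (\<lambda>x. representation B (proj X) x + b X n * (if x = n then 1 else 0))"
    if "X \<in> V" for X
  proof -
    have "proj X \<in> span B" using proj_mem[OF that] B by simp
    then have 1: "representation ?C (proj X) = representation B (proj X)"
      by (intro representation_extend[OF C(1)]) auto
    have "representation ?C X = representation ?C (proj X + b X n *\<^sub>R n)"
      by (simp add: proj_def)
    also have "\<dots> = (\<lambda>x. representation ?C (proj X) x + representation ?C (b X n *\<^sub>R n) x)"
      using C n subspace_scale[OF V n] hyperplane_sub[OF proj_mem[OF that]]
      by (intro representation_add) auto
    also have "\<dots> = (\<lambda>x. representation B (proj X) x + b X n * (if x = n then 1 else 0))"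
      using representation_scale[OF C(1), of n] C(2) n by (simp add: 1 rep_n)
    finally show ?thesis .
  qed
  have "endo_on hyperplane (\<lambda>X. proj (L X))"
    using endo_on_compose[OF endo_on_proj L] endo_on_mem[OF L] proj_mem hyperplane_sub
    by (simp add: endo_on_def)
  then have "trace_on hyperplane (\<lambda>X. proj (L X)) = (\<Sum>x\<in>B. representation B (proj (L x)) x)"
    by (rule trace_on_basis[OF _ B(1,2)])
  moreover have "trace_on V L = (\<Sum>x\<in>?C. representation ?C (L x) x)"
    by (rule trace_on_basis[OF L C])
  moreover have "representation ?C (L n) n = b (L n) n"
    using rep[OF endo_on_mem[OF L n]] nB representation_ne_zero[of B _ n] by auto
  moreover have "representation ?C (L x) x = representation B (proj (L x)) x" if "x \<in> B" for x
  proof -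
    have "x \<in> V" using span_base[OF that] unfolding B(2) by (rule hyperplane_sub)
    then show ?thesis using rep[OF endo_on_mem[OF L]] nB that by auto
  qed
  ultimately show ?thesis using nB B(3) by simp
qed

end

section \<open>Compressed almost Hermitian structures\<close>

lemma cyclic_shifts:
  fixes a :: 3
  shows "a + 1 + 1 = a + 2" "a + 1 + 2 = a" "a + 2 + 1 = a" "a + 2 + 2 = a + 1"
  by (simp_all add: add.assoc)

text \<open>
  What the Kaehler and the quaternionic Kaehler structure look like in a single tangent space \<open>V\<close> of
  the ambient manifold, with a unit normal vector \<open>n\<close>.
\<close>

locale hypersurface_structure = unit_normal V b n
  for V :: "'v::euclidean_space set" and b n +
  fixes J :: "'v \<Rightarrow> 'v" and Js :: "3 \<Rightarrow> 'v \<Rightarrow> 'v"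
  assumes endo_J: "endo_on V J" and endo_Js: "endo_on V (Js a)"
    and square_J: "X \<in> V \<Longrightarrow> J (J X) = - X" and square_Js: "X \<in> V \<Longrightarrow> Js a (Js a X) = - X"
    and isometry_J: "X \<in> V \<Longrightarrow> Y \<in> V \<Longrightarrow> b (J X) (J Y) = b X Y"
    and isometry_Js: "X \<in> V \<Longrightarrow> Y \<in> V \<Longrightarrow> b (Js a X) (Js a Y) = b X Y"
    and commute: "X \<in> V \<Longrightarrow> J (Js a X) = Js a (J X)"
    and quaternion: "X \<in> V \<Longrightarrow> Js a (Js (a + 1) X) = Js (a + 2) X"
    and anticommute: "X \<in> V \<Longrightarrow> Js (a + 1) (Js a X) = - Js (a + 2) X"
begin

lemmas mem = endo_on_mem[OF endo_J] endo_on_mem[OF endo_Js]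

lemma skew_J: "X \<in> V \<Longrightarrow> Y \<in> V \<Longrightarrow> b (J X) Y = - b X (J Y)"
  using isometry_J[of X "J Y"] square_J[of Y] minus_right[of "J X" Y] mem by simp

lemma skew_Js: "X \<in> V \<Longrightarrow> Y \<in> V \<Longrightarrow> b (Js a X) Y = - b X (Js a Y)"
  using isometry_Js[of X "Js a Y" a] square_Js[of Y a] minus_right[of "Js a X" Y] mem by simp

lemma orthogonal_J: "b (J n) n = 0" and orthogonal_Js: "b (Js a n) n = 0"
  using skew_J[OF n n] skew_Js[OF n n] sym n mem by force+

abbreviation "\<xi> \<equiv> struct_vec J n"
abbreviation "\<eta> \<equiv> struct_form b J n"
abbreviation "\<phi> \<equiv> struct_endo b J n"
abbreviation "\<xi>' a \<equiv> struct_vec (Js a) n"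
abbreviation "\<eta>' a \<equiv> struct_form b (Js a) n"
abbreviation "\<phi>' a \<equiv> struct_endo b (Js a) n"

definition theta :: "3 \<Rightarrow> 'v \<Rightarrow> 'v"
  where "theta a X = \<phi>' a (\<phi> X) - (\<xi>' a \<otimes> \<eta>) X"

lemma eta: "X \<in> V \<Longrightarrow> \<eta> X = b (J X) n"
  using skew_J[OF _ n] minus_right[OF _ mem(1)[OF n]] by (simp add: struct_form_def struct_vec_def)

lemma eta': "X \<in> V \<Longrightarrow> \<eta>' a X = b (Js a X) n"
  using skew_Js[OF _ n] minus_right[OF _ mem(2)[OF n]] by (simp add: struct_form_def struct_vec_def)

lemma phi: "X \<in> V \<Longrightarrow> \<phi> X = proj (J X)"
  and phi': "X \<in> V \<Longrightarrow> \<phi>' a X = proj (Js a X)"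
  by (simp_all add: struct_endo_def proj_def eta eta')

lemma proj_xi: "proj (J n) = J n" "proj (Js a n) = Js a n"
  by (simp_all add: proj_def orthogonal_J orthogonal_Js)

text \<open>
  Since \<open>J X\<close> has normal part \<open>\<eta>(X) n\<close>, compressing twice loses \<open>\<eta>(X) pr (J\<^sub>a n) = - \<eta>(X) \<xi>\<^sub>a\<close>, which
  is what the summand \<open>- \<xi>\<^sub>a \<otimes> \<eta>\<close> gives back.
\<close>

lemma theta_proj: "X \<in> V \<Longrightarrow> theta a X = proj (J (Js a X))"
  using proj_compose[OF endo_Js mem(1), of X a] mem n proj_mem hyperplane_sub
  by (simp add: theta_def phi phi' tensor_def struct_vec_def proj_xi eta commute)

text \<open>
  A skew map sends \<open>n\<close> into the hyperplane, so the normal part of the argument does not contribute.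
\<close>

lemma form_proj:
  assumes "Y \<in> V"
  shows "b (J (proj Y)) n = b (J Y) n" "b (Js a (proj Y)) n = b (Js a Y) n"
  using assms n mem endo_on_diff[OF endo_J V] endo_on_scale[OF endo_J]
    endo_on_diff[OF endo_Js V] endo_on_scale[OF endo_Js] subspace_scale[OF V]
  by (simp_all add: proj_def diff_left scale_left orthogonal_J orthogonal_Js)

lemma endo_theta: "endo_on V (\<lambda>X. J (Js a X))"
  by (rule endo_on_compose[OF endo_J endo_Js])

text \<open>
  The three collections below decide the identities by rewriting. Every tensor becomes \<open>pr\<close> of a word
  in \<open>J\<close> and the \<open>J\<^sub>a\<close>, inner projections are expanded, \<open>J\<close> moves to the front, and the
  multiplication rules shorten the words. The first collection discharges the side conditions
  that vectors lie in \<open>V\<close>.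
\<close>

lemmas closed = n mem subspace_neg[OF V] subspace_add[OF V] subspace_diff[OF V] subspace_scale[OF V]
  proj_mem[THEN hyperplane_sub]

lemmas linear =
  endo_on_minus[OF endo_J] endo_on_diff[OF endo_J V] endo_on_scale[OF endo_J]
  endo_on_minus[OF endo_Js] endo_on_diff[OF endo_Js V] endo_on_scale[OF endo_Js]
  proj_minus endo_on_diff[OF endo_on_proj V] endo_on_scale[OF endo_on_proj]
  minus_left diff_left scale_left

lemmas normal_form = eta eta' phi phi' theta_proj form_proj struct_vec_def tensor_def proj_xi proj_id
  orthogonal_J orthogonal_Js commute[symmetric] square_J square_Js quaternion anticommute
  (* the simplifier does not match modulo 3, so the three cyclic instances are given separately *)
  quaternion[of _ "a + 1" for a, unfolded cyclic_shifts]
  anticommute[of _ "a + 1" for a, unfolded cyclic_shifts]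
  quaternion[of _ "a + 2" for a, unfolded cyclic_shifts]
  anticommute[of _ "a + 2" for a, unfolded cyclic_shifts]
  proj_compose[OF endo_J] proj_compose[OF endo_Js] proj_compose[OF endo_theta]
  proj_normal unit

lemma symmetric_theta: "symmetric_on hyperplane b (theta a)"
proof -
  have tang: "b (proj X) Y = b X Y" if "X \<in> V" "Y \<in> hyperplane" for X Y
    using that n sym[of n Y] hyperplane_sub[OF that(2)] subspace_scale[OF V n]
    by (simp add: proj_def diff_left scale_left hyperplane_def)
  have "b (J (Js a X)) Y = b X (J (Js a Y))" if "X \<in> V" "Y \<in> V" for X Y
    using that by (simp add: skew_J skew_Js closed commute)
  then show ?thesis
    using tang sym proj_mem mem hyperplane_sub
    unfolding symmetric_on_def by (simp add: theta_proj)
qed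

lemma trace_theta: "trace_on hyperplane (theta a) = \<eta> (\<xi>' a)"
proof -
  let ?K = "Js (a + 1)"
  have "trace_on V (\<lambda>X. J (Js a X)) = 0"
  \<comment> \<open>\<open>?K\<close> commutes with \<open>J\<close> and anticommutes with \<open>Js a\<close>.\<close>
  proof (rule trace_on_anticommute[OF V endo_theta endo_Js])
    show "V \<subseteq> ?K ` V"
    proof
      fix X assume "X \<in> V"
      then have "X = ?K (- ?K X)" "- ?K X \<in> V"
        by (simp_all add: linear closed square_Js)
      then show "X \<in> ?K ` V" by blast
    qed
    show "J (Js a (?K X)) = - ?K (J (Js a X))" if "X \<in> V" for X
      using that by (simp add: normal_form linear closed)
  qed
  moreover have "trace_on hyperplane (theta a) = trace_on hyperplane (\<lambda>X. proj (J (Js a X)))"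
    by (rule trace_on_cong[OF subspace_hyperplane]) (simp add: theta_proj hyperplane_sub)
  ultimately show ?thesis
    using trace_on_hyperplane[OF endo_theta] by (simp add: normal_form closed linear)
qed

lemma theta_xi: "theta a \<xi> = - \<xi>' a"
  and theta_xi': "theta a (\<xi>' a) = - \<xi>"
  and theta_phi_xi': "theta a (\<phi> (\<xi>' a)) = \<eta> (\<xi>' a) *\<^sub>R \<phi> (\<xi>' a)"
  by (simp_all add: normal_form closed linear)

lemma theta_xi'_next: "theta a (\<xi>' (a + 1)) = \<phi> (\<xi>' (a + 2))"
  and theta_next_xi': "\<phi> (\<xi>' (a + 2)) = - theta (a + 1) (\<xi>' a)"
  by (simp_all add: normal_form closed linear)

lemma theta_phi_xi'_next:
  "- theta a (\<phi> (\<xi>' (a + 1))) + \<eta> (\<xi>' (a + 1)) *\<^sub>R \<phi> (\<xi>' a) = \<xi>' (a + 2)"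
  "\<xi>' (a + 2) = theta (a + 1) (\<phi> (\<xi>' a)) - \<eta> (\<xi>' a) *\<^sub>R \<phi> (\<xi>' (a + 1))"
  by (simp_all add: normal_form closed linear)

context
  fixes X assumes X: "X \<in> hyperplane"
begin

lemma theta_theta: "theta a (theta a X) - (\<phi> (\<xi>' a) \<otimes> (\<eta>' a \<circ> \<phi>)) X = X"
  using X by (simp add: normal_form closed linear hyperplane_sub)

lemma theta_theta_next:
  "- theta a (theta (a + 1) X) + (\<phi> (\<xi>' a) \<otimes> (\<eta>' (a + 1) \<circ> \<phi>)) X = \<phi>' (a + 2) X"
  "\<phi>' (a + 2) X = theta (a + 1) (theta a X) - (\<phi> (\<xi>' (a + 1)) \<otimes> (\<eta>' a \<circ> \<phi>)) X"
  using X by (simp_all add: normal_form closed linear hyperplane_sub)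

lemma theta_phi:
  "theta a (\<phi> X) - (\<phi> (\<xi>' a) \<otimes> \<eta>) X = - \<phi>' a X"
  "- \<phi>' a X = \<phi> (theta a X) - (\<xi> \<otimes> (\<eta>' a \<circ> \<phi>)) X"
  using X by (simp_all add: normal_form closed linear hyperplane_sub)

lemma theta_phi':
  "theta a (\<phi>' a X) - (\<phi> (\<xi>' a) \<otimes> \<eta>' a) X = - \<phi> X"
  "- \<phi> X = \<phi>' a (theta a X) - (\<xi>' a \<otimes> (\<eta>' a \<circ> \<phi>)) X"
  using X by (simp_all add: normal_form closed linear hyperplane_sub)

lemma theta_phi'_next:
  "theta a (\<phi>' (a + 1) X) - (\<phi> (\<xi>' a) \<otimes> \<eta>' (a + 1)) X = theta (a + 2) X"
  "theta (a + 2) X = - \<phi>' (a + 1) (theta a X) + (\<xi>' (a + 1) \<otimes> (\<eta>' a \<circ> \<phi>)) X"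
  using X by (simp_all add: normal_form closed linear hyperplane_sub)

end

end

section \<open>Tangent spaces of the Grassmannian\<close>

lemma matrix_mul_distribs:
  fixes A B C :: "'a::ring_1 ^ 'n::finite ^ 'n"
  shows "(A + B) ** C = A ** C + B ** C" "A ** (B + C) = A ** B + A ** C"
    "(A - B) ** C = A ** C - B ** C" "A ** (B - C) = A ** B - A ** C"
    "(- A) ** C = - (A ** C)" "A ** (- C) = - (A ** C)"
    "0 ** A = 0" "A ** 0 = 0"
  by (simp_all add: matrix_matrix_mult_def vec_eq_iff sum.distrib sum_subtractf sum_negf algebra_simps)

lemma matrix_mul_scaleR:
  fixes A B :: "'a::real_algebra_1 ^ 'n::finite ^ 'n"
  shows "(r *\<^sub>R A) ** B = r *\<^sub>R (A ** B)" "A ** (r *\<^sub>R B) = r *\<^sub>R (A ** B)"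
  by (simp_all add: matrix_matrix_mult_def vec_eq_iff scaleR_sum_right)

lemma cadjoint_mul: "cadjoint (A ** B) = cadjoint B ** cadjoint A"
  by (simp add: cadjoint_def matrix_matrix_mult_def vec_eq_iff mult.commute)

lemma cadjoint_simps:
  "cadjoint (A + B) = cadjoint A + cadjoint B" "cadjoint (A - B) = cadjoint A - cadjoint B"
  "cadjoint (- A) = - cadjoint A" "cadjoint (r *\<^sub>R A) = r *\<^sub>R cadjoint A" "cadjoint (mat 1) = mat 1"
  "cadjoint 0 = 0"
  by (auto simp: cadjoint_def vec_eq_iff mat_def)

lemma linear_lie: "linear (lie A)"
  by (rule linearI) (simp_all add: lie_def matrix_mul_distribs matrix_mul_scaleR algebra_simps)

lemma lie_jacobi: "lie (lie A B) X = lie A (lie B X) - lie B (lie A X)"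
  by (simp add: lie_def matrix_mul_distribs matrix_mul_assoc)

lemma trace_lie: "trace (lie A B) = 0"
proof -
  have "trace (A - B) = trace A - trace B" for A B :: "'a cmat"
    by (simp add: trace_def sum_subtractf)
  then show ?thesis by (simp add: lie_def trace_mul_sym[of A B])
qed

text \<open>
  The determinant condition is what makes \<open>matrix_inv\<close> a true inverse.
\<close>

lemma isometry_inverse:
  assumes "A \<in> isometry_group c"
  shows "A ** matrix_inv A = mat 1" "matrix_inv A ** A = mat 1"
proof -
  have "invertible A" using assms by (simp add: isometry_group_def invertible_det_nz)
  then have "\<exists>B. A ** B = mat 1 \<and> B ** A = mat 1" by (simp add: invertible_def)
  then have "A ** matrix_inv A = mat 1 \<and> matrix_inv A ** A = mat 1"
    unfolding matrix_inv_def by (rule someI_ex)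
  then show "A ** matrix_inv A = mat 1" "matrix_inv A ** A = mat 1" by auto
qed

text \<open>
  With these two rules the Hermitian form passes through a conjugation, for points as well as for
  tangent vectors.
\<close>

lemma cadjoint_herm_isometry:
  assumes A: "A \<in> isometry_group c"
  shows "cadjoint A ** herm_form c = herm_form c ** matrix_inv A"
    and "cadjoint (matrix_inv A) ** herm_form c = herm_form c ** A"
proof -
  let ?B = "matrix_inv A" and ?H = "herm_form c :: 'a cmat"
  have eq: "cadjoint A ** ?H ** A = ?H" using A by (simp add: isometry_group_def)
  have "cadjoint A ** ?H = cadjoint A ** ?H ** (A ** ?B)"
    by (simp add: isometry_inverse[OF A])
  also have "\<dots> = ?H ** ?B" by (simp add: matrix_mul_assoc eq)
  finally show "cadjoint A ** ?H = ?H ** ?B" .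
  have "cadjoint ?B ** ?H = cadjoint ?B ** (cadjoint A ** ?H ** A)" by (simp add: eq)
  also have "\<dots> = cadjoint (A ** ?B) ** ?H ** A" by (simp add: cadjoint_mul matrix_mul_assoc)
  finally show "cadjoint ?B ** ?H = ?H ** A"
    by (simp add: isometry_inverse[OF A] cadjoint_simps)
qed

lemma base_point_entry: "base_point $ i $ j = (if i = j \<and> (\<exists>k. i = Inl k) then 1 else 0)"
  by (simp add: base_point_def)

lemma diagonal_mul:
  fixes D X :: "'a::comm_ring_1 ^ 'n::finite ^ 'n"
  assumes "\<And>i j. i \<noteq> j \<Longrightarrow> D $ i $ j = 0"
  shows "(D ** X) $ i $ j = D $ i $ i * X $ i $ j" "(X ** D) $ i $ j = X $ i $ j * D $ j $ j"
proof -
  have "(D ** X) $ i $ j = (\<Sum>k\<in>UNIV. D $ i $ k * X $ k $ j)"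
    "(X ** D) $ i $ j = (\<Sum>k\<in>UNIV. X $ i $ k * D $ k $ j)"
    by (simp_all add: matrix_matrix_mult_def)
  moreover have "(\<Sum>k\<in>UNIV. D $ i $ k * X $ k $ j) = (\<Sum>k\<in>{i}. D $ i $ k * X $ k $ j)"
    "(\<Sum>k\<in>UNIV. X $ i $ k * D $ k $ j) = (\<Sum>k\<in>{j}. X $ i $ k * D $ k $ j)"
    by (rule sum.mono_neutral_right; use assms in auto)+
  ultimately show "(D ** X) $ i $ j = D $ i $ i * X $ i $ j" "(X ** D) $ i $ j = X $ i $ j * D $ j $ j"
    by simp_all
qed

lemma herm_form_entry:
  "herm_form c $ i $ j = (if i \<noteq> j then 0 else case i of Inl _ \<Rightarrow> (if c < 0 then - 1 else 1) | Inr _ \<Rightarrow> 1)"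
  by (simp add: herm_form_def)

lemma base_point_mul:
  fixes X :: "('m::finite) cmat"
  shows "(base_point ** X) $ i $ j = (if \<exists>k. i = Inl k then X $ i $ j else 0)"
  "(X ** base_point) $ i $ j = (if \<exists>k. j = Inl k then X $ i $ j else 0)"
  using diagonal_mul[of base_point X i j] by (simp_all add: base_point_entry)

lemma herm_form_mul:
  fixes X :: "('m::finite) cmat"
  shows "(herm_form c ** X) $ i $ j = herm_form c $ i $ i * X $ i $ j"
  "(X ** herm_form c) $ i $ j = X $ i $ j * herm_form c $ j $ j"
  using diagonal_mul[of "herm_form c" X i j] by (simp_all add: herm_form_entry)

lemma base_point_projection:
  "base_point ** base_point = base_point"
  "cadjoint base_point ** herm_form c = herm_form c ** base_point"
  by (auto simp: vec_eq_iff base_point_mul herm_form_mul base_point_entry herm_form_entry cadjoint_def)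

text \<open>
  The equations of the Grassmannian: its points are projections which are self-adjoint for the
  Hermitian form. Both properties hold at the base point and survive conjugation by isometries.
\<close>

lemma grassmannian_projection:
  assumes "P \<in> grassmannian c"
  shows "P ** P = P" "cadjoint P ** herm_form c = herm_form c ** P"
proof -
  obtain A where A: "A \<in> isometry_group c" and P: "P = A ** base_point ** matrix_inv A"
    using assms by (auto simp: grassmannian_def conj_by_def)
  have "P ** P = A ** base_point ** (matrix_inv A ** A) ** base_point ** matrix_inv A"
    by (simp add: P matrix_mul_assoc)
  also have "\<dots> = A ** (base_point ** base_point) ** matrix_inv A"
    by (simp only: isometry_inverse[OF A] matrix_mul_rid) (simp only: matrix_mul_assoc)
  finally show "P ** P = P" by (simp add: base_point_projection P)
  have "cadjoint P ** herm_form c = cadjoint (matrix_inv A) ** cadjoint base_point ** (cadjoint A ** herm_form c)"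
    by (simp add: P cadjoint_mul matrix_mul_assoc)
  also have "\<dots> = cadjoint (matrix_inv A) ** (cadjoint base_point ** herm_form c) ** matrix_inv A"
    by (simp only: cadjoint_herm_isometry[OF A] matrix_mul_assoc)
  also have "\<dots> = (cadjoint (matrix_inv A) ** herm_form c) ** base_point ** matrix_inv A"
    by (simp only: base_point_projection matrix_mul_assoc)
  also have "\<dots> = herm_form c ** P"
    by (simp only: cadjoint_herm_isometry[OF A] matrix_mul_assoc P)
  finally show "cadjoint P ** herm_form c = herm_form c ** P" .
qed

text \<open>
  The linearized equations describe the tangent space. A solution \<open>X\<close> satisfies \<open>P X P = 0\<close>, as
  follows by multiplying the first equation by \<open>P\<close> on both sides; therefore \<open>X = [[X, P], P]\<close>,
  and \<open>[X, P]\<close> lies in the Lie algebra of the isometry group.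
\<close>

lemma grass_tangent_iff:
  assumes P: "P \<in> grassmannian c"
  shows "X \<in> grass_tangent c P \<longleftrightarrow>
    X ** P + P ** X = X \<and> cadjoint X ** herm_form c = herm_form c ** X"
proof
  note PP = grassmannian_projection[OF P]
  let ?H = "herm_form c :: 'a cmat"
  {
    assume "X \<in> grass_tangent c P"
    then obtain U where U: "U \<in> isometry_alg c" and X: "X = U ** P - P ** U"
      by (auto simp: grass_tangent_def lie_def)
    have UH: "cadjoint U ** ?H = - (?H ** U)"
      using U by (simp add: isometry_alg_def eq_neg_iff_add_eq_0)
    have "X ** P + P ** X = (U ** (P ** P) - P ** U ** P) + (P ** U ** P - (P ** P) ** U)"
      by (simp add: X matrix_mul_distribs matrix_mul_assoc)
    then have 1: "X ** P + P ** X = X" by (simp add: PP X)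
    have "cadjoint X ** ?H = cadjoint P ** (cadjoint U ** ?H) - cadjoint U ** (cadjoint P ** ?H)"
      by (simp add: X cadjoint_simps cadjoint_mul matrix_mul_distribs matrix_mul_assoc)
    also have "\<dots> = - ((cadjoint P ** ?H) ** U) - (cadjoint U ** ?H) ** P"
      by (simp only: PP UH matrix_mul_distribs matrix_mul_assoc)
    also have "\<dots> = ?H ** X"
      by (simp add: PP UH X matrix_mul_distribs matrix_mul_assoc)
    finally show "X ** P + P ** X = X \<and> cadjoint X ** ?H = ?H ** X" using 1 by simp
  }
  {
    assume "X ** P + P ** X = X \<and> cadjoint X ** ?H = ?H ** X"
    then have X: "X ** P + P ** X = X" and XH: "cadjoint X ** ?H = ?H ** X" by auto
    have "P ** X ** P = P ** (X ** P + P ** X) ** P" by (simp add: X)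
    also have "\<dots> = P ** X ** (P ** P) + (P ** P) ** X ** P"
      by (simp only: matrix_mul_distribs matrix_mul_assoc)
    also have "\<dots> = P ** X ** P + P ** X ** P" by (simp add: PP)
    finally have PXP: "P ** X ** P = 0" by simp
    have "lie (lie X P) P = X ** (P ** P) - P ** X ** P - (P ** X ** P - (P ** P) ** X)"
      by (simp add: lie_def matrix_mul_distribs matrix_mul_assoc)
    also have "\<dots> = X" by (simp add: PP PXP X)
    finally have 1: "lie (lie X P) P = X" .
    have "cadjoint (lie X P) ** ?H = cadjoint P ** (cadjoint X ** ?H) - cadjoint X ** (cadjoint P ** ?H)"
      by (simp add: lie_def cadjoint_simps cadjoint_mul matrix_mul_distribs matrix_mul_assoc)
    also have "\<dots> = (cadjoint P ** ?H) ** X - (cadjoint X ** ?H) ** P"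
      by (simp only: PP XH matrix_mul_assoc)
    also have "\<dots> = - (?H ** lie X P)"
      by (simp add: PP XH lie_def matrix_mul_distribs matrix_mul_assoc)
    finally have "lie X P \<in> isometry_alg c"
      by (simp add: isometry_alg_def trace_lie)
    then show "X \<in> grass_tangent c P" using 1 by (force simp: grass_tangent_def)
  }
qed

lemma subspace_grass_tangent:
  assumes P: "P \<in> grassmannian c"
  shows "subspace (grass_tangent c P)"
proof (rule subspaceI)
  show "0 \<in> grass_tangent c P"
    by (simp add: grass_tangent_iff[OF P] matrix_mul_distribs cadjoint_simps)
next
  fix X Y assume "X \<in> grass_tangent c P" "Y \<in> grass_tangent c P"
  then have X: "X ** P + P ** X = X" "cadjoint X ** herm_form c = herm_form c ** X"
    and Y: "Y ** P + P ** Y = Y" "cadjoint Y ** herm_form c = herm_form c ** Y"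
    by (simp_all add: grass_tangent_iff[OF P])
  have "(X + Y) ** P + P ** (X + Y) = (X ** P + P ** X) + (Y ** P + P ** Y)"
    by (simp add: matrix_mul_distribs)
  then show "X + Y \<in> grass_tangent c P"
    by (simp add: X Y grass_tangent_iff[OF P] matrix_mul_distribs cadjoint_simps)
next
  fix X r assume "X \<in> grass_tangent c P"
  then have X: "X ** P + P ** X = X" "cadjoint X ** herm_form c = herm_form c ** X"
    by (simp_all add: grass_tangent_iff[OF P])
  have "(r *\<^sub>R X) ** P + P ** (r *\<^sub>R X) = r *\<^sub>R (X ** P + P ** X)"
    by (simp add: matrix_mul_scaleR scaleR_add_right)
  then show "r *\<^sub>R X \<in> grass_tangent c P"
    by (simp add: X grass_tangent_iff[OF P] matrix_mul_scaleR cadjoint_simps)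
qed

text \<open>
  A tangent vector at the base point is off-diagonal in the block decomposition \<open>2 + m\<close>, and its
  lower block is determined by the upper one through self-adjointness. The upper block has \<open>2 m\<close>
  complex entries.
\<close>

lemma dim_tangent_base_point:
  fixes S :: "('m::finite) cmat set"
  assumes S: "\<And>X. X \<in> S \<Longrightarrow> X ** base_point + base_point ** X = X"
    "\<And>X. X \<in> S \<Longrightarrow> cadjoint X ** herm_form c = herm_form c ** X"
  and "subspace S"
  shows "dim S \<le> 4 * CARD('m)"
proof -
  define h :: "'m cmat \<Rightarrow> complex ^ 'm ^ 2" where "h X = (\<chi> i j. X $ Inl i $ Inr j)" for X
  have "linear h"
    by (rule linearI) (simp_all add: h_def vec_eq_iff)
  moreover have "inj_on h S"
  proof (subst linear_inj_on_iff_eq_0[OF \<open>linear h\<close> \<open>subspace S\<close>], safe)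
    fix X assume X: "X \<in> S" "h X = 0"
    have upper: "X $ Inl i $ Inr j = 0" for i j
      using X(2) by (simp add: h_def vec_eq_iff)
    have 1: "(X ** base_point + base_point ** X) $ i $ j = X $ i $ j" for i j
      using S(1)[OF X(1)] by simp
    have 2: "(cadjoint X ** herm_form c) $ i $ j = (herm_form c ** X) $ i $ j" for i j
      using S(2)[OF X(1)] by simp
    have "X $ i $ j = 0" for i j
    proof (cases i; cases j)
      fix k l assume "i = Inr k" "j = Inl l"
      then show ?thesis
        using 2[of i j] upper by (simp add: herm_form_mul herm_form_entry cadjoint_def split: if_splits)
    qed (use 1[of i j] upper in \<open>auto simp: base_point_mul\<close>)
    then show "X = 0" by (simp add: vec_eq_iff)
  qed
  ultimately have "dim S = dim (h ` S)"
    using assms(3) by (metis dim_image_eq span_eq_iff)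
  also have "\<dots> \<le> DIM(complex ^ 'm ^ 2)" by (rule dim_subset_UNIV)
  finally show ?thesis by simp
qed

text \<open>
  Conjugation by an isometry moves \<open>P\<close> to the base point.
\<close>

lemma dim_grass_tangent:
  fixes P :: "('m::finite) cmat"
  assumes P: "P \<in> grassmannian c"
  shows "dim (grass_tangent c P) \<le> 4 * CARD('m)"
proof -
  obtain A where A: "A \<in> isometry_group c" and PA: "P = A ** base_point ** matrix_inv A"
    using P by (auto simp: grassmannian_def conj_by_def)
  define k where "k X = matrix_inv A ** X ** A" for X
  have "linear k"
    by (rule linearI) (simp_all add: k_def matrix_mul_distribs matrix_mul_scaleR)
  have kinv: "A ** k X ** matrix_inv A = X" for X
  proof -
    have "A ** k X ** matrix_inv A = (A ** matrix_inv A) ** X ** (A ** matrix_inv A)"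
      by (simp only: k_def matrix_mul_assoc)
    then show ?thesis by (simp add: isometry_inverse[OF A])
  qed
  have kmul: "k (X ** Y) = k X ** k Y" for X Y
  proof -
    have "k X ** k Y = matrix_inv A ** X ** (A ** matrix_inv A) ** Y ** A"
      by (simp only: k_def matrix_mul_assoc)
    then show ?thesis by (simp add: isometry_inverse[OF A] k_def matrix_mul_assoc)
  qed
  have "k P = (matrix_inv A ** A) ** base_point ** (matrix_inv A ** A)"
    by (simp only: k_def PA matrix_mul_assoc)
  then have kP: "k P = base_point" by (simp add: isometry_inverse[OF A])
  have "inj k" by (metis injI kinv)
  have "dim (grass_tangent c P) = dim (k ` grass_tangent c P)"
    using \<open>inj k\<close> \<open>linear k\<close> by (metis dim_image_eq inj_on_subset subset_UNIV)
  also have "\<dots> \<le> 4 * CARD('m)"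
  proof (rule dim_tangent_base_point)
    show "subspace (k ` grass_tangent c P)"
      by (rule linear_subspace_image[OF \<open>linear k\<close> subspace_grass_tangent[OF P]])
    fix Y assume "Y \<in> k ` grass_tangent c P"
    then obtain X where X: "X ** P + P ** X = X" "cadjoint X ** herm_form c = herm_form c ** X"
      and Y: "Y = k X"
      using grass_tangent_iff[OF P] by auto
    show "Y ** base_point + base_point ** Y = Y"
      using arg_cong[OF X(1), of k] by (simp add: linear_add[OF \<open>linear k\<close>] kmul kP Y)
    have "cadjoint Y ** herm_form c = cadjoint A ** cadjoint X ** (cadjoint (matrix_inv A) ** herm_form c)"
      by (simp add: Y k_def cadjoint_mul matrix_mul_assoc)
    also have "\<dots> = cadjoint A ** (cadjoint X ** herm_form c) ** A"
      by (simp only: cadjoint_herm_isometry[OF A] matrix_mul_assoc)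
    also have "\<dots> = (cadjoint A ** herm_form c) ** X ** A"
      by (simp only: X matrix_mul_assoc)
    also have "\<dots> = herm_form c ** Y"
      by (simp only: cadjoint_herm_isometry[OF A] matrix_mul_assoc Y k_def)
    finally show "cadjoint Y ** herm_form c = herm_form c ** Y" .
  qed
  finally show ?thesis .
qed

lemma smooth_on_differentiable:
  assumes "smooth_on S h" "x \<in> S"
  shows "(h has_derivative frechet_derivative h (at x)) (at x)"
  using assms by (metis frechet_derivative_works differentiableI smooth_on.cases)

text \<open>
  Differentiate the two equations that hold along \<open>h\<close>.
\<close>

lemma derivative_in_grass_tangent:
  fixes h :: "'e::euclidean_space \<Rightarrow> ('m::finite) cmat"
  assumes S: "open S" "x \<in> S" and h: "h ` S \<subseteq> grassmannian c"
    and D: "(h has_derivative D) (at x)"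
  shows "D v \<in> grass_tangent c (h x)"
proof -
  have bil: "bounded_bilinear ((**) :: 'm cmat \<Rightarrow> 'm cmat \<Rightarrow> 'm cmat)"
    by (simp add: bilinear_conv_bounded_bilinear[symmetric] bilinear_def linear_iff
        matrix_mul_distribs matrix_mul_scaleR)
  have hP: "h x \<in> grassmannian c" using S h by auto
  have "((\<lambda>y. h y ** h y) has_derivative (\<lambda>v. h x ** D v + D v ** h x)) (at x)"
    by (rule bounded_bilinear.FDERIV[OF bil D D])
  then have "(h has_derivative (\<lambda>v. h x ** D v + D v ** h x)) (at x)"
    by (rule has_derivative_transform_within_open[OF _ S]) (use h grassmannian_projection in blast)
  then have "D = (\<lambda>v. h x ** D v + D v ** h x)"
    by (rule has_derivative_unique[OF D])
  then have 1: "D v ** h x + h x ** D v = D v" by (metis add.commute)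
  define l where "l X = cadjoint X ** herm_form c - herm_form c ** X" for X :: "'m cmat"
  have "linear l"
    by (rule linearI)
      (simp_all add: l_def cadjoint_simps matrix_mul_distribs matrix_mul_scaleR algebra_simps)
  then have "bounded_linear l" by (simp add: linear_conv_bounded_linear)
  then have "((\<lambda>y. l (h y)) has_derivative (\<lambda>v. l (D v))) (at x)"
    by (rule bounded_linear.has_derivative[OF _ D])
  moreover have "l (h y) = 0" if "y \<in> S" for y
    using that h grassmannian_projection(2)[of "h y" c] by (auto simp: l_def)
  ultimately have "((\<lambda>y. 0) has_derivative (\<lambda>v. l (D v))) (at x)"
    using has_derivative_transform_within_open[OF _ S] by fastforce
  then have "(\<lambda>v. l (D v)) = (\<lambda>v. 0)"
    by (rule has_derivative_unique) simp
  then have "l (D v) = 0" by metis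
  then show ?thesis using 1 by (simp add: grass_tangent_iff[OF hP] l_def)
qed

section \<open>Real hypersurfaces of the Grassmannian\<close>

text \<open>
  All parametrizations around \<open>p\<close> contribute to \<open>immersed_tangent\<close>. Each contributes vectors
  orthogonal to the normal, and already the image of a single one has the dimension of the
  whole hyperplane; so no comparison of charts is involved.
\<close>

lemma immersed_tangent_eq_hyperplane:
  fixes \<A> :: "('e::euclidean_space, 'p::{t2_space, second_countable_topology}) atlas"
    and f N :: "'p \<Rightarrow> ('m::finite) cmat"
  assumes M: "oriented_real_hypersurface c g \<A> f N"
    and un: "unit_normal (grass_tangent c (f p)) (g (f p)) (N p)"
  shows "immersed_tangent \<A> f p = unit_normal.hyperplane (grass_tangent c (f p)) (g (f p)) (N p)"
proof -
  interpret unit_normal "grass_tangent c (f p)" "g (f p)" "N p" by (rule un)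
  have atlas: "smooth_atlas \<A>" and imm: "smooth_immersion \<A> f" and fG: "range f \<subseteq> grassmannian c"
    and dimM: "DIM('e) = 4 * CARD('m) - 1"
    and perp: "\<And>X. X \<in> immersed_tangent \<A> f p \<Longrightarrow> g (f p) X (N p) = 0"
    using M by (auto simp: oriented_real_hypersurface_def)
  have deriv: "((f \<circ> \<psi>) has_derivative frechet_derivative (f \<circ> \<psi>) (at v)) (at v)"
    if "(V, \<psi>) \<in> \<A>" "v \<in> V" for V \<psi> v
    using imm that by (auto simp: smooth_immersion_def smooth_map_def intro!: smooth_on_differentiable)
  have openV: "open V" if "(V, \<psi>) \<in> \<A>" for V \<psi>
    using atlas that by (auto simp: smooth_atlas_def)
  have sub: "immersed_tangent \<A> f p \<subseteq> hyperplane"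
  proof
    fix X assume X: "X \<in> immersed_tangent \<A> f p"
    then obtain V \<psi> v w where *: "(V, \<psi>) \<in> \<A>" "v \<in> V" "\<psi> v = p"
      and Xw: "X = frechet_derivative (f \<circ> \<psi>) (at v) w"
      by (auto simp: immersed_tangent_def)
    have "(f \<circ> \<psi>) ` V \<subseteq> grassmannian c" using fG by auto
    then have "X \<in> grass_tangent c ((f \<circ> \<psi>) v)"
      unfolding Xw by (rule derivative_in_grass_tangent[OF openV[OF *(1)] *(2) _ deriv[OF *(1,2)]])
    then show "X \<in> hyperplane"
      using *(3) perp[OF X] by (simp add: hyperplane_def)
  qed
  have "p \<in> (\<Union>(V, \<psi>)\<in>\<A>. \<psi> ` V)" using atlas by (simp add: smooth_atlas_def)
  then obtain V \<psi> v where *: "(V, \<psi>) \<in> \<A>" "v \<in> V" "\<psi> v = p" by auto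
  define D where "D = frechet_derivative (f \<circ> \<psi>) (at v)"
  have "inj D" using imm *(1,2) by (auto simp: smooth_immersion_def D_def)
  have "linear D" using has_derivative_linear[OF deriv[OF *(1,2)]] by (simp add: D_def)
  have rangeD: "range D \<subseteq> immersed_tangent \<A> f p"
    using * by (auto simp: immersed_tangent_def D_def)
  have "f p \<in> grassmannian c" using fG by auto
  then have "dim hyperplane \<le> DIM('e)"
    using dim_grass_tangent[of "f p" c] dim_hyperplane dimM by simp
  also have "\<dots> = dim (range D)"
    using dim_image_eq[OF \<open>linear D\<close>, of UNIV] \<open>inj D\<close> by simp
  finally have "range D = hyperplane"
    using subspace_dim_equal[OF linear_subspace_image[OF \<open>linear D\<close> subspace_UNIV] subspace_hyperplane]
      rangeD sub by auto
  then show ?thesis using rangeD sub by auto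
qed

text \<open>
  Jacobi identity with \<open>[Z, U] = 0\<close>.
\<close>

lemma lie_central_commute:
  assumes "Z \<in> isotropy_center c P" "U \<in> isotropy_alg c P"
  shows "lie Z (lie U X) = lie U (lie Z X)"
proof -
  have "lie Z U = 0" using assms by (simp add: isotropy_center_def)
  then show ?thesis using lie_jacobi[of Z U X] by (simp add: lie_def matrix_mul_distribs)
qed

lemma endo_on_lie:
  assumes "\<And>X. X \<in> V \<Longrightarrow> L X = lie U X" "\<And>X. X \<in> V \<Longrightarrow> L X \<in> V" "subspace V"
  shows "endo_on V L"
  unfolding endo_on_def
  using assms linear_add[OF linear_lie, of U] linear_scale[OF linear_lie, of U]
  by (simp add: subspace_add subspace_scale)

lemma hypersurface_structure_at:
  fixes \<A> :: "('e::euclidean_space, 'p::{t2_space, second_countable_topology}) atlas"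
    and f N :: "'p \<Rightarrow> ('m::finite) cmat"
  assumes g: "invariant_metric c g" and J: "kahler_structure c g J"
    and Js: "canonical_local_basis c g W Js"
    and M: "oriented_real_hypersurface c g \<A> f N" and W: "f p \<in> W"
  shows "hypersurface_structure (grass_tangent c (f p)) (g (f p)) (N p) (J (f p)) (\<lambda>a. Js a (f p))"
proof -
  let ?V = "grass_tangent c (f p)"
  have P: "f p \<in> grassmannian c" using M by (auto simp: oriented_real_hypersurface_def)
  have V: "subspace ?V" by (rule subspace_grass_tangent[OF P])
  have "almost_hermitian_at c g (f p) (J (f p))"
    using J P by (simp add: kahler_structure_def)
  then have herm: "J (f p) X \<in> ?V" "J (f p) (J (f p) X) = - X"
      "Y \<in> ?V \<Longrightarrow> g (f p) (J (f p) X) (J (f p) Y) = g (f p) X Y" if "X \<in> ?V" for X Y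
    using that by (auto simp: almost_hermitian_at_def)
  obtain Z where Z: "Z \<in> isotropy_center c (f p)" "\<And>X. X \<in> ?V \<Longrightarrow> J (f p) X = lie Z X"
    using J P by (auto simp: kahler_structure_def)
  have almost: "almost_hermitian_at c g (f p) (Js a (f p))" for a
    using Js W by (simp add: canonical_local_basis_def)
  then have herm': "Js a (f p) X \<in> ?V" "Js a (f p) (Js a (f p) X) = - X"
      "Y \<in> ?V \<Longrightarrow> g (f p) (Js a (f p) X) (Js a (f p) Y) = g (f p) X Y" if "X \<in> ?V" for a X Y
    using that by (auto simp: almost_hermitian_at_def)
  have quat: "Js a (f p) (Js (a + 1) (f p) X) = Js (a + 2) (f p) X"
      "Js (a + 2) (f p) X = - Js (a + 1) (f p) (Js a (f p) X)" if "X \<in> ?V" for a X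
    using Js W that unfolding canonical_local_basis_def by blast+
  obtain U where U: "\<And>a. U a (f p) \<in> isotropy_su2 c (f p)"
      "\<And>a X. X \<in> ?V \<Longrightarrow> Js a (f p) X = lie (U a (f p)) X"
    using Js W unfolding canonical_local_basis_def by blast
  show ?thesis
  proof
    show "inner_product_on ?V (g (f p))" using g P by (simp add: invariant_metric_def)
    show "N p \<in> ?V" "g (f p) (N p) (N p) = 1" using M by (auto simp: oriented_real_hypersurface_def)
    show "endo_on ?V (J (f p))" by (rule endo_on_lie[OF Z(2) herm(1) V])
    show "endo_on ?V (Js a (f p))" for a by (rule endo_on_lie[OF U(2) herm'(1) V])
    show "J (f p) (Js a (f p) X) = Js a (f p) (J (f p) X)" if "X \<in> ?V" for a X
      using lie_central_commute[OF Z(1), of "U a (f p)" X] U(1)[of a] that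
      by (simp add: Z(2) U(2) herm(1) herm'(1) isotropy_su2_def flip: Z(2) U(2))
    show "Js (a + 1) (f p) (Js a (f p) X) = - Js (a + 2) (f p) X" if "X \<in> ?V" for a X
      using quat(2)[OF that, of a] by simp
  qed (fact V herm herm' quat(1))+
qed

theorem lemma3p2:
  fixes c :: real
    and g :: "('m::finite) metric"
    and J :: "'m endo_field"
    and Js :: "3 \<Rightarrow> 'm endo_field"
    and W :: "'m cmat set"
    and \<A> :: "('e::euclidean_space, 'p::{t2_space, second_countable_topology}) atlas"
    and f N :: "'p \<Rightarrow> 'm cmat"
    and p :: 'p
    and \<xi> :: "'m cmat" and \<eta> :: "'m cmat \<Rightarrow> real" and \<phi> :: "'m cmat \<Rightarrow> 'm cmat"
    and \<xi>' :: "3 \<Rightarrow> 'm cmat" and \<eta>' :: "3 \<Rightarrow> 'm cmat \<Rightarrow> real" and \<phi>' \<theta> :: "3 \<Rightarrow> 'm cmat \<Rightarrow> 'm cmat"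
    and T :: "'m cmat set"
    and a :: 3
  assumes "CARD('m) \<ge> 3" and "c \<noteq> 0"
    and "grassmannian_metric c g"
    and "kahler_structure c g J"
    and "canonical_local_basis c g W Js"
    and "oriented_real_hypersurface c g \<A> f N"
    and "f p \<in> W"
    and T: "T = immersed_tangent \<A> f p"
    and \<xi>: "\<xi> = struct_vec (J (f p)) (N p)"
    and \<eta>: "\<eta> = struct_form (g (f p)) (J (f p)) (N p)"
    and \<phi>: "\<phi> = struct_endo (g (f p)) (J (f p)) (N p)"
    and \<xi>': "\<xi>' = (\<lambda>a. struct_vec (Js a (f p)) (N p))"
    and \<eta>': "\<eta>' = (\<lambda>a. struct_form (g (f p)) (Js a (f p)) (N p))"
    and \<phi>': "\<phi>' = (\<lambda>a. struct_endo (g (f p)) (Js a (f p)) (N p))"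
    and \<theta>: "\<theta> = (\<lambda>a X. \<phi>' a (\<phi> X) - (\<xi>' a \<otimes> \<eta>) X)"
  shows "(symmetric_on T (g (f p)) (\<theta> a)) \<and>
    (trace_on T (\<theta> a) = \<eta> (\<xi>' a)) \<and>
    (\<theta> a \<xi> = - \<xi>' a \<and> \<theta> a (\<xi>' a) = - \<xi> \<and> \<theta> a (\<phi> (\<xi>' a)) = \<eta> (\<xi>' a) *\<^sub>R \<phi> (\<xi>' a)) \<and>
    (\<theta> a (\<xi>' (a + 1)) = \<phi> (\<xi>' (a + 2)) \<and> \<phi> (\<xi>' (a + 2)) = - \<theta> (a + 1) (\<xi>' a)) \<and>
    (\<forall>X\<in>T. \<theta> a (\<theta> a X) - (\<phi> (\<xi>' a) \<otimes> (\<eta>' a \<circ> \<phi>)) X = X) \<and>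
    (- \<theta> a (\<phi> (\<xi>' (a + 1))) + \<eta> (\<xi>' (a + 1)) *\<^sub>R \<phi> (\<xi>' a) = \<xi>' (a + 2) \<and>
      \<xi>' (a + 2) = \<theta> (a + 1) (\<phi> (\<xi>' a)) - \<eta> (\<xi>' a) *\<^sub>R \<phi> (\<xi>' (a + 1))) \<and>
    (\<forall>X\<in>T. - \<theta> a (\<theta> (a + 1) X) + (\<phi> (\<xi>' a) \<otimes> (\<eta>' (a + 1) \<circ> \<phi>)) X = \<phi>' (a + 2) X \<and>
      \<phi>' (a + 2) X = \<theta> (a + 1) (\<theta> a X) - (\<phi> (\<xi>' (a + 1)) \<otimes> (\<eta>' a \<circ> \<phi>)) X) \<and>
    (\<forall>X\<in>T. \<theta> a (\<phi> X) - (\<phi> (\<xi>' a) \<otimes> \<eta>) X = - \<phi>' a X \<and>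
      - \<phi>' a X = \<phi> (\<theta> a X) - (\<xi> \<otimes> (\<eta>' a \<circ> \<phi>)) X) \<and>
    (\<forall>X\<in>T. \<theta> a (\<phi>' a X) - (\<phi> (\<xi>' a) \<otimes> \<eta>' a) X = - \<phi> X \<and>
      - \<phi> X = \<phi>' a (\<theta> a X) - (\<xi>' a \<otimes> (\<eta>' a \<circ> \<phi>)) X) \<and>
    (\<forall>X\<in>T. \<theta> a (\<phi>' (a + 1) X) - (\<phi> (\<xi>' a) \<otimes> \<eta>' (a + 1)) X = \<theta> (a + 2) X \<and>
      \<theta> (a + 2) X = - \<phi>' (a + 1) (\<theta> a X) + (\<xi>' (a + 1) \<otimes> (\<eta>' a \<circ> \<phi>)) X)"
proof -
  have g: "invariant_metric c g" using assms(3) by (simp add: grassmannian_metric_def)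
  interpret hypersurface_structure "grass_tangent c (f p)" "g (f p)" "N p" "J (f p)"
    "\<lambda>a. Js a (f p)"
    by (rule hypersurface_structure_at[OF g assms(4-7)])
  have hyp: "T = hyperplane"
    unfolding T by (rule immersed_tangent_eq_hyperplane[OF assms(6) unit_normal_axioms])
  have theta: "\<theta> = theta"
    by (simp add: fun_eq_iff theta_def \<xi> \<eta> \<phi> \<xi>' \<eta>' \<phi>' \<theta>)
  show ?thesis
    unfolding theta hyp \<xi> \<eta> \<phi> \<xi>' \<eta>' \<phi>'
    by (intro conjI ballI symmetric_theta trace_theta theta_xi theta_xi' theta_phi_xi'
        theta_xi'_next theta_next_xi' theta_theta theta_phi_xi'_next theta_theta_next
        theta_phi theta_phi' theta_phi'_next)
qed

end
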